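(* Let $H$ be a separable Hilbert space, $\{H_i\}_{i\in I}$ a family of Hilbert spaces, $C,C'$ bounded invertible operators on $H$ with bounded inverses, and $\Lambda=\{\Lambda_i\in\mathcal B(H,H_i)\}_{i\in I}$ a family such that $P_i:=C^*\Lambda_i^*\Lambda_iC'$ is a positive operator on $H$ for each $i\in I$. Let $0<B<\infty$. Then $\Lambda$ is a $CC'$-controlled g-Bessel sequence for $H$ with bound $B$ if and only if the operator $$T_{CC'}:K\to H,\qquad T_{CC'}\big(\{P_i^{1/2}f\}_{i\in I}\big)=\sum_{i\in I}C^*\Lambda_i^*\Lambda_iC'f$$ is well-defined and bounded with $\|T_{CC'}\|\le\sqrt{B}$, where $K=\big\{\{P_i^{1/2}f\}_{i\in I}: f\in H\big\}$ is regarded as a subspace of $\ell^2(I,H)$.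
   Context: $\mathcal B(H,K)$ denotes the bounded linear operators from $H$ to $K$. $\Lambda$ is a $CC'$-controlled g-Bessel sequence for $H$ with bound $B$ if $\sum_{i\in I}\langle \Lambda_iC'f,\Lambda_iCf\rangle\le B\|f\|^2$ for all $f\in H$ (the terms equal $\langle P_if,f\rangle\ge 0$). $\ell^2(I,H)$ is the Hilbert space of families $\{g_i\}_{i\in I}$ in $H$ with $\sum_i\|g_i\|^2<\infty$, with its usual inner product. "Well-defined" means: for each $f\in H$ the family $\{P_i^{1/2}f\}_{i\in I}$ belongs to $\ell^2(I,H)$, the series $\sum_{i\in I}P_if$ converges unconditionally in $H$, and its sum depends only on the family $\{P_i^{1/2}f\}_{i\in I}$. Positive operators are self-adjoint and $P_i^{1/2}$ is the positive square root. *)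

theory Defs
  imports "HOL-Analysis.Analysis" "HOL-Algebra.Module"
begin

section \<open>Scalars\<close>

class rc_scalar = real_normed_field +
  fixes conjg :: "'a \<Rightarrow> 'a"
  assumes conjg_add: "conjg (x + y) = conjg x + conjg y"
    and mult_conjg: "x * conjg x = (norm x)\<^sup>2 *\<^sub>R 1"

text \<open>
  A real normed field (so \<open>norm (x * y) = norm x * norm y\<close>) is isomorphic to the reals or to the
  complex numbers, and on either of them the axioms leave only the usual conjugation. A
  statement over \<^class>\<open>rc_scalar\<close> therefore treats real and complex Hilbert spaces at once.
\<close>

instantiation real :: rc_scalar
begin
definition conjg_real :: "real \<Rightarrow> real" where "conjg_real x = x"
instance by standard (simp_all add: conjg_real_def power2_eq_square)
end

instantiation complex :: rc_scalar
begin
definition conjg_complex :: "complex \<Rightarrow> complex" where "conjg_complex = cnj"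
instance by standard (simp_all add: conjg_complex_def complex_norm_square[symmetric] scaleR_conv_of_real del: of_real_power)
end

section \<open>Hilbert spaces\<close>

text \<open>
  A Hilbert space whose points form a whole type. The class \<open>{real_inner, complete_space}\<close> supplies
  the underlying real Hilbert space, hence norm, topology, completeness and infinite sums; \<open>sc\<close> and
  \<open>ip\<close> are scalar multiplication and inner product over \<open>'k\<close>. By polarization the real inner product
  \<open>inner\<close> is the real part of \<open>ip\<close>. Inner products are linear in the first argument.
\<close>

locale hilbert_type = vector_space sc
  for sc :: "'k::rc_scalar \<Rightarrow> 'h::{real_inner, complete_space} \<Rightarrow> 'h" +
  fixes ip :: "'h \<Rightarrow> 'h \<Rightarrow> 'k"
  assumes sc_of_real: "sc (of_real r) x = r *\<^sub>R x"
    and ip_add: "ip (x + y) z = ip x z + ip y z"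
    and ip_sc: "ip (sc c x) z = c * ip x z"
    and ip_conjg: "ip y x = conjg (ip x y)"
    and ip_self: "ip x x = of_real ((norm x)\<^sup>2)"

text \<open>
  A Hilbert space on an arbitrary carrier set with its own operations, needed for families
  whose members are unrelated spaces. The fields \<open>mult\<close> and \<open>one\<close> that module
  records inherit from rings are unused.
\<close>

definition scalar_ring :: "'k::field ring" where
  "scalar_ring = \<lparr>carrier = UNIV, mult = (*), one = 1, zero = 0, add = (+)\<rparr>"

record ('k, 'v) hspace = "('k, 'v) module" +
  hip :: "'v \<Rightarrow> 'v \<Rightarrow> 'k"

definition hnorm :: "('k::rc_scalar, 'v) hspace \<Rightarrow> 'v \<Rightarrow> real" where
  "hnorm X x = sqrt (norm (hip X x x))"

text \<open>
  The value off the carrier only serves \<^locale>\<open>Metric_space\<close>, which requires a distance to be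
  symmetric on the whole type.
\<close>

definition hdist :: "('k::rc_scalar, 'v) hspace \<Rightarrow> 'v \<Rightarrow> 'v \<Rightarrow> real" where
  "hdist X x y = (if x \<in> carrier X \<and> y \<in> carrier X then hnorm X (x \<ominus>\<^bsub>X\<^esub> y) else 0)"

definition hilbert_space :: "('k::rc_scalar, 'v) hspace \<Rightarrow> bool" where
  "hilbert_space X \<longleftrightarrow>
     Module.module scalar_ring X \<and>
     (\<forall>x\<in>carrier X. \<forall>y\<in>carrier X. \<forall>z\<in>carrier X. hip X (x \<oplus>\<^bsub>X\<^esub> y) z = hip X x z + hip X y z) \<and>
     (\<forall>c. \<forall>x\<in>carrier X. \<forall>z\<in>carrier X. hip X (c \<odot>\<^bsub>X\<^esub> x) z = c * hip X x z) \<and>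
     (\<forall>x\<in>carrier X. \<forall>y\<in>carrier X. hip X y x = conjg (hip X x y)) \<and>
     (\<forall>x\<in>carrier X. x \<noteq> \<zero>\<^bsub>X\<^esub> \<longrightarrow> (\<exists>r>0. hip X x x = of_real r)) \<and>
     Metric_space.mcomplete (carrier X) (hdist X)"

section \<open>Operators\<close>

definition bounded_op ::
  "('k::rc_scalar \<Rightarrow> 'h::real_normed_vector \<Rightarrow> 'h) \<Rightarrow> ('h \<Rightarrow> 'h) \<Rightarrow> bool" where
  "bounded_op sc T \<longleftrightarrow> bounded_linear T \<and> (\<forall>c x. T (sc c x) = sc c (T x))"

definition bounded_op_to ::
  "('k::rc_scalar \<Rightarrow> 'h::real_normed_vector \<Rightarrow> 'h) \<Rightarrow> ('k, 'v) hspace \<Rightarrow> ('h \<Rightarrow> 'v) \<Rightarrow> bool" where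
  "bounded_op_to sc X T \<longleftrightarrow>
     (\<forall>x. T x \<in> carrier X) \<and>
     (\<forall>x y. T (x + y) = T x \<oplus>\<^bsub>X\<^esub> T y) \<and>
     (\<forall>c x. T (sc c x) = c \<odot>\<^bsub>X\<^esub> T x) \<and>
     (\<exists>M. \<forall>x. hnorm X (T x) \<le> M * norm x)"

text \<open>
  The adjoint, with respect to the inner products \<open>ip\<close> of the domain and \<open>ip'\<close> of the codomain. If
  the codomain is a carrier set, only the values there are meaningful.
\<close>

definition adj :: "('h \<Rightarrow> 'h \<Rightarrow> 'k) \<Rightarrow> ('v \<Rightarrow> 'v \<Rightarrow> 'k) \<Rightarrow> ('h \<Rightarrow> 'v) \<Rightarrow> 'v \<Rightarrow> 'h" where
  "adj ip ip' T y = (THE z. \<forall>x. ip' (T x) y = ip x z)"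

definition positive_op ::
  "('k::rc_scalar \<Rightarrow> 'h::real_normed_vector \<Rightarrow> 'h) \<Rightarrow> ('h \<Rightarrow> 'h \<Rightarrow> 'k) \<Rightarrow> ('h \<Rightarrow> 'h) \<Rightarrow> bool" where
  "positive_op sc ip P \<longleftrightarrow>
     bounded_op sc P \<and> adj ip ip P = P \<and> (\<forall>x. \<exists>r\<ge>0. ip (P x) x = of_real r)"

definition op_sqrt ::
  "('k::rc_scalar \<Rightarrow> 'h::real_normed_vector \<Rightarrow> 'h) \<Rightarrow> ('h \<Rightarrow> 'h \<Rightarrow> 'k) \<Rightarrow> ('h \<Rightarrow> 'h) \<Rightarrow> 'h \<Rightarrow> 'h" where
  "op_sqrt sc ip P = (THE S. positive_op sc ip S \<and> S \<circ> S = P)"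

section \<open>Controlled g-Bessel sequences\<close>

definition ctrl_op ::
  "('h \<Rightarrow> 'h \<Rightarrow> 'k) \<Rightarrow> ('i \<Rightarrow> ('k::rc_scalar, 'v) hspace) \<Rightarrow> ('h \<Rightarrow> 'h) \<Rightarrow> ('h \<Rightarrow> 'h)
     \<Rightarrow> ('i \<Rightarrow> 'h \<Rightarrow> 'v) \<Rightarrow> 'i \<Rightarrow> 'h \<Rightarrow> 'h" where
  "ctrl_op ip X C C' \<Lambda> i f = adj ip ip C (adj ip (hip (X i)) (\<Lambda> i) (\<Lambda> i (C' f)))"

definition controlled_g_Bessel ::
  "('i \<Rightarrow> ('k::rc_scalar, 'v) hspace) \<Rightarrow> ('h::real_normed_vector \<Rightarrow> 'h) \<Rightarrow> ('h \<Rightarrow> 'h)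
     \<Rightarrow> 'i set \<Rightarrow> ('i \<Rightarrow> 'h \<Rightarrow> 'v) \<Rightarrow> real \<Rightarrow> bool" where
  "controlled_g_Bessel X C C' I \<Lambda> B \<longleftrightarrow>
     (\<forall>f. \<exists>s. ((\<lambda>i. hip (X i) (\<Lambda> i (C' f)) (\<Lambda> i (C f))) has_sum of_real s) I \<and> s \<le> B * (norm f)\<^sup>2)"

text \<open>Families indexed by \<open>I\<close> are \<^const>\<open>extensional\<close>, so that equal families are equal functions.\<close>

definition ell2 :: "'i set \<Rightarrow> ('i \<Rightarrow> 'h::real_normed_vector) set" where
  "ell2 I = {g \<in> extensional I. (\<lambda>i. (norm (g i))\<^sup>2) summable_on I}"

definition ell2_norm :: "'i set \<Rightarrow> ('i \<Rightarrow> 'h::real_normed_vector) \<Rightarrow> real" where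
  "ell2_norm I g = sqrt (\<Sum>\<^sub>\<infinity>i\<in>I. (norm (g i))\<^sup>2)"

section \<open>The synthesis operator of a family of positive operators\<close>

definition sqrt_family ::
  "('k::rc_scalar \<Rightarrow> 'h::real_normed_vector \<Rightarrow> 'h) \<Rightarrow> ('h \<Rightarrow> 'h \<Rightarrow> 'k) \<Rightarrow> 'i set
     \<Rightarrow> ('i \<Rightarrow> 'h \<Rightarrow> 'h) \<Rightarrow> 'h \<Rightarrow> 'i \<Rightarrow> 'h" where
  "sqrt_family sc ip I P f = (\<lambda>i\<in>I. op_sqrt sc ip (P i) f)"

definition synth_dom ::
  "('k::rc_scalar \<Rightarrow> 'h::real_normed_vector \<Rightarrow> 'h) \<Rightarrow> ('h \<Rightarrow> 'h \<Rightarrow> 'k) \<Rightarrow> 'i set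
     \<Rightarrow> ('i \<Rightarrow> 'h \<Rightarrow> 'h) \<Rightarrow> ('i \<Rightarrow> 'h) set" where
  "synth_dom sc ip I P = range (sqrt_family sc ip I P)"

definition synth_well_defined ::
  "('k::rc_scalar \<Rightarrow> 'h::real_normed_vector \<Rightarrow> 'h) \<Rightarrow> ('h \<Rightarrow> 'h \<Rightarrow> 'k) \<Rightarrow> 'i set
     \<Rightarrow> ('i \<Rightarrow> 'h \<Rightarrow> 'h) \<Rightarrow> bool" where
  "synth_well_defined sc ip I P \<longleftrightarrow>
     (\<forall>f. sqrt_family sc ip I P f \<in> ell2 I \<and> (\<lambda>i. P i f) summable_on I) \<and>
     (\<forall>f f'. sqrt_family sc ip I P f = sqrt_family sc ip I P f' \<longrightarrow>
        (\<Sum>\<^sub>\<infinity>i\<in>I. P i f) = (\<Sum>\<^sub>\<infinity>i\<in>I. P i f'))"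

definition synth ::
  "('k::rc_scalar \<Rightarrow> 'h::real_normed_vector \<Rightarrow> 'h) \<Rightarrow> ('h \<Rightarrow> 'h \<Rightarrow> 'k) \<Rightarrow> 'i set
     \<Rightarrow> ('i \<Rightarrow> 'h \<Rightarrow> 'h) \<Rightarrow> ('i \<Rightarrow> 'h) \<Rightarrow> 'h" where
  "synth sc ip I P g = (THE h. \<exists>f. g = sqrt_family sc ip I P f \<and> h = (\<Sum>\<^sub>\<infinity>i\<in>I. P i f))"

definition ell2_bounded_on :: "'i set \<Rightarrow> ('i \<Rightarrow> 'h::real_normed_vector) set \<Rightarrow> (('i \<Rightarrow> 'h) \<Rightarrow> 'h) \<Rightarrow> bool" where
  "ell2_bounded_on I K T \<longleftrightarrow> (\<exists>M. \<forall>g\<in>K. norm (T g) \<le> M * ell2_norm I g)"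

text \<open>As in \<^const>\<open>onorm\<close>, the zero family contributes \<open>0 / 0 = 0\<close>.\<close>

definition ell2_onorm_on :: "'i set \<Rightarrow> ('i \<Rightarrow> 'h::real_normed_vector) set \<Rightarrow> (('i \<Rightarrow> 'h) \<Rightarrow> 'h) \<Rightarrow> real" where
  "ell2_onorm_on I K T = (SUP g\<in>K. norm (T g) / ell2_norm I g)"

end

theory Submission
  imports Defs
begin

text \<open>
  Everything rests on \<open>\<parallel>P\<^sub>i\<^sup>1\<^sup>/\<^sup>2 f\<parallel>\<^sup>2 = \<langle>P\<^sub>i f, f\<rangle>\<close>: the Bessel sum is the squared \<open>\<ell>\<^sup>2\<close> norm of the family
  \<open>P\<^sub>i\<^sup>1\<^sup>/\<^sup>2 f\<close>. If it is at most \<open>B \<parallel>f\<parallel>\<^sup>2\<close>, the Cauchy-Schwarz inequality for a finite partial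
  sum \<open>Q = \<Sum> P\<^sub>i\<close> gives \<open>\<parallel>Q f\<parallel>\<^sup>2 \<le> B \<langle>Q f, f\<rangle>\<close>, which yields both unconditional convergence and
  the bound \<open>sqrt B\<close>. Conversely \<open>\<parallel>g\<parallel>\<^sup>2 = \<langle>T g, f\<rangle> \<le> sqrt B \<parallel>g\<parallel> \<parallel>f\<parallel>\<close> for the family \<open>g\<close> of \<open>f\<close>.
  Since \<open>op_sqrt\<close> and \<open>adj\<close> are definite descriptions, existence and uniqueness of positive square
  roots and of Riesz representatives have to be proved as well.
\<close>

section \<open>Scalars with conjugation\<close>

text \<open>The real part, read off from \<open>(norm (x + 1))\<^sup>2 = (x + 1) * (conjg x + 1)\<close>.\<close>

definition rc_re :: "'a::rc_scalar \<Rightarrow> real" where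
  "rc_re x = ((norm (x + 1))\<^sup>2 - (norm x)\<^sup>2 - 1) / 2"

lemma mult_conjg_of_real: "x * conjg x = of_real ((norm x)\<^sup>2)" for x :: "'a::rc_scalar"
  by (simp add: mult_conjg scaleR_conv_of_real)

lemma conjg_zero [simp]: "conjg (0 :: 'a::rc_scalar) = 0"
  using conjg_add[of "0 :: 'a" 0] by simp

text \<open>The class gives only additivity and the value of \<open>x * conjg x\<close>; this law
  and the multiplicative ones below come from computing such a product and cancelling a nonzero
  factor.\<close>

lemma conjg_of_real [simp]: "conjg (of_real r) = (of_real r :: 'a::rc_scalar)"
proof (cases "r = 0")
  case False
  have "of_real r * conjg (of_real r) = (of_real r * of_real r :: 'a)"
    by (simp add: mult_conjg_of_real power2_eq_square del: of_real_power)
  with False show ?thesis by simp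
qed simp

lemma conjg_one [simp]: "conjg (1 :: 'a::rc_scalar) = 1"
  using conjg_of_real[of 1] by (simp del: conjg_of_real)

lemma norm_conjg [simp]: "norm (conjg x) = norm x" for x :: "'a::rc_scalar"
proof (cases "x = 0")
  case False
  have "norm x * norm (conjg x) = norm x * norm x"
    using arg_cong[OF mult_conjg_of_real[of x], of norm]
    by (simp add: norm_mult power2_eq_square del: of_real_power)
  with False show ?thesis by simp
qed simp

lemma conjg_mult: "conjg (x * y) = conjg x * conjg y" for x y :: "'a::rc_scalar"
proof (cases "x * y = 0")
  case False
  have "(x * y) * conjg (x * y) = of_real ((norm x)\<^sup>2) * of_real ((norm y)\<^sup>2)"
    by (simp add: mult_conjg_of_real norm_mult power_mult_distrib)
  also have "\<dots> = (x * y) * (conjg x * conjg y)"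
    unfolding mult_conjg_of_real[symmetric] by (simp add: mult_ac)
  finally show ?thesis using False by simp
qed auto

lemma conjg_conjg [simp]: "conjg (conjg x) = x" for x :: "'a::rc_scalar"
proof (cases "x = 0")
  case False
  have "conjg x * conjg (conjg x) = conjg x * x"
    using mult_conjg_of_real[of "conjg x"] mult_conjg_of_real[of x] by (simp add: mult.commute)
  moreover have "conjg x \<noteq> 0" using False norm_conjg[of x] by (metis norm_eq_zero)
  ultimately show ?thesis by simp
qed simp

lemma add_conjg: "x + conjg x = of_real (2 * rc_re x)" for x :: "'a::rc_scalar"
proof -
  have "(x + 1) * conjg (x + 1) = x * conjg x + (x + conjg x) + 1"
    by (simp add: conjg_add algebra_simps)
  then show ?thesis
    unfolding mult_conjg_of_real by (simp add: rc_re_def algebra_simps)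
qed

lemma rc_re_add: "rc_re (x + y) = rc_re x + rc_re y" for x y :: "'a::rc_scalar"
proof -
  have "of_real (2 * rc_re (x + y)) = (of_real (2 * (rc_re x + rc_re y)) :: 'a)"
    unfolding add_conjg[symmetric] distrib_left of_real_add by (simp add: conjg_add algebra_simps)
  then show ?thesis unfolding of_real_eq_iff by simp
qed

lemma rc_re_of_real_mult: "rc_re (of_real r * x) = r * rc_re x" for x :: "'a::rc_scalar"
proof -
  have "of_real (2 * rc_re (of_real r * x)) = (of_real r * of_real (2 * rc_re x) :: 'a)"
    unfolding add_conjg[symmetric] by (simp add: conjg_mult algebra_simps)
  then have "of_real (2 * rc_re (of_real r * x)) = (of_real (r * (2 * rc_re x)) :: 'a)"
    unfolding of_real_mult .
  then show ?thesis unfolding of_real_eq_iff by simp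
qed

lemma rc_re_of_real [simp]: "rc_re (of_real r :: 'a::rc_scalar) = r"
proof -
  have "of_real (2 * rc_re (of_real r :: 'a)) = (of_real (2 * r) :: 'a)"
    unfolding add_conjg[symmetric] by simp
  then show ?thesis unfolding of_real_eq_iff by simp
qed

lemma rc_re_minus: "rc_re (- x) = - rc_re x" for x :: "'a::rc_scalar"
  using rc_re_of_real_mult[of "-1" x] by simp

lemma rc_re_diff: "rc_re (x - y) = rc_re x - rc_re y" for x y :: "'a::rc_scalar"
  using rc_re_add[of x "- y"] by (simp add: rc_re_minus)

lemma abs_rc_re_le_norm: "\<bar>rc_re x\<bar> \<le> norm x" for x :: "'a::rc_scalar"
proof -
  have "norm (of_real (2 * rc_re x) :: 'a) \<le> norm x + norm (conjg x)"
    unfolding add_conjg[symmetric] by (rule norm_triangle_ineq)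
  then show ?thesis unfolding norm_of_real by simp
qed

text \<open>The multiplier \<open>conjg (x - y)\<close> turns the difference into a squared norm.
  Letting \<open>c\<close> vary avoids an imaginary unit, which real scalars lack.\<close>

lemma rc_scalar_eqI:
  fixes x y :: "'a::rc_scalar"
  assumes "\<And>c. rc_re (c * x) = rc_re (c * y)"
  shows "x = y"
proof -
  have "rc_re (conjg (x - y) * (x - y)) = 0"
    using assms[of "conjg (x - y)"] by (simp add: right_diff_distrib rc_re_diff)
  then have "(norm (x - y))\<^sup>2 = 0"
    unfolding mult.commute[of "conjg (x - y)"] mult_conjg_of_real rc_re_of_real .
  then show ?thesis by simp
qed

section \<open>Positive operators on a real inner product space\<close>

text \<open>Positivity with respect to the real inner product only. Symmetry is a separate clause
  because over the reals a nonnegative quadratic form does not imply it.\<close>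

definition pos_sym :: "('h::real_inner \<Rightarrow> 'h) \<Rightarrow> bool" where
  "pos_sym Q \<longleftrightarrow> linear Q \<and> (\<forall>x y. inner (Q x) y = inner x (Q y)) \<and> (\<forall>x. 0 \<le> inner (Q x) x)"

lemma pos_symD:
  assumes "pos_sym Q"
  shows "linear Q" and "inner (Q x) y = inner x (Q y)" and "0 \<le> inner (Q x) x"
  using assms by (auto simp: pos_sym_def)

text \<open>The form may be degenerate. Along the line through \<open>x\<close> in direction
  \<open>y\<close> it is a nonnegative quadratic in \<open>t\<close>: for \<open>c > 0\<close> it is
  evaluated at the vertex \<open>- b / c\<close>, and for \<open>c = 0\<close> a nonzero slope would
  produce the value \<open>-1\<close>.\<close>

lemma pos_sym_Cauchy_Schwarz:
  assumes "pos_sym Q"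
  shows "(inner (Q x) y)\<^sup>2 \<le> inner (Q x) x * inner (Q y) y"
proof -
  define a b c where "a = inner (Q x) x" and "b = inner (Q x) y" and "c = inner (Q y) y"
  have quadratic: "0 \<le> a + 2 * t * b + t\<^sup>2 * c" for t
  proof -
    have "0 \<le> inner (Q (x + t *\<^sub>R y)) (x + t *\<^sub>R y)"
      using pos_symD(3)[OF assms] .
    also have "\<dots> = a + 2 * t * b + t\<^sup>2 * c"
      using pos_symD(2)[OF assms, of y x]
      by (simp add: linear_add[OF pos_symD(1)[OF assms]] linear_scale[OF pos_symD(1)[OF assms]]
          a_def b_def c_def inner_add_left inner_add_right power2_eq_square inner_commute algebra_simps)
    finally show ?thesis .
  qed
  have "c \<ge> 0" using pos_symD(3)[OF assms] by (simp add: c_def)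
  have "b\<^sup>2 \<le> a * c"
  proof (cases "c = 0")
    case True
    have "b = 0"
    proof (rule ccontr)
      assume "b \<noteq> 0"
      then show False using quadratic[of "- (a + 1) / (2 * b)"] True by (simp add: field_simps)
    qed
    then show ?thesis using True by simp
  next
    case False
    then show ?thesis
      using quadratic[of "- b / c"] \<open>c \<ge> 0\<close> by (simp add: power2_eq_square field_simps)
  qed
  then show ?thesis by (simp add: a_def b_def c_def)
qed

text \<open>Cauchy-Schwarz for the form of \<open>Q\<close> with \<open>y = Q x\<close>, after which
  one factor \<open>(norm (Q x))\<^sup>2\<close> cancels.\<close>

lemma pos_sym_norm_le:
  assumes "pos_sym Q" and bound: "\<And>x. inner (Q x) x \<le> B * (norm x)\<^sup>2"
  shows "(norm (Q x))\<^sup>2 \<le> B * inner (Q x) x"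
proof (cases "Q x = 0")
  case False
  have "((norm (Q x))\<^sup>2)\<^sup>2 \<le> inner (Q x) x * inner (Q (Q x)) (Q x)"
    using pos_sym_Cauchy_Schwarz[OF assms(1), of x "Q x"] by (simp add: power2_norm_eq_inner)
  also have "\<dots> \<le> inner (Q x) x * (B * (norm (Q x))\<^sup>2)"
    by (intro mult_left_mono bound pos_symD(3)[OF assms(1)])
  finally have "(norm (Q x))\<^sup>2 * (norm (Q x))\<^sup>2 \<le> (B * inner (Q x) x) * (norm (Q x))\<^sup>2"
    by (simp add: power2_eq_square mult_ac)
  then show ?thesis by (rule mult_right_le_imp_le) (use False in simp)
qed simp

lemma bounded_linear_inner_le:
  fixes Q :: "'h::real_inner \<Rightarrow> 'h"
  assumes "bounded_linear Q"
  obtains B where "0 < B" and "\<And>x. inner (Q x) x \<le> B * (norm x)\<^sup>2"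
proof -
  obtain B where B: "0 < B" "\<And>x. norm (Q x) \<le> norm x * B"
    using bounded_linear.pos_bounded[OF assms] by auto
  have "inner (Q x) x \<le> B * (norm x)\<^sup>2" for x
  proof -
    have "inner (Q x) x \<le> norm (Q x) * norm x" by (rule norm_cauchy_schwarz)
    also have "\<dots> \<le> (norm x * B) * norm x" by (intro mult_right_mono B) simp
    finally show ?thesis by (simp add: power2_eq_square mult_ac)
  qed
  with B(1) show thesis using that by blast
qed

lemma pos_sym_eq_zero:
  assumes "pos_sym Q" "bounded_linear Q" "inner (Q x) x = 0"
  shows "Q x = 0"
proof -
  obtain B where "\<And>x. inner (Q x) x \<le> B * (norm x)\<^sup>2"
    using bounded_linear_inner_le[OF assms(2)] by blast
  from pos_sym_norm_le[OF assms(1) this, of x] assms(3) show ?thesis by simp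
qed

subsection \<open>Square roots\<close>

text \<open>The recursion replaces \<open>Y\<close> by \<open>(A + Y\<^sup>2) / 2\<close>; started
  at \<open>0\<close>, it yields polynomials in \<open>A\<close> with nonnegative
  coefficients.\<close>

primrec half_iter :: "('h::real_vector \<Rightarrow> 'h) \<Rightarrow> nat \<Rightarrow> 'h \<Rightarrow> 'h" where
  "half_iter A 0 = (\<lambda>x. 0)"
| "half_iter A (Suc n) = (\<lambda>x. (1/2) *\<^sub>R (A x + half_iter A n (half_iter A n x)))"

lemma linear_half_iter:
  assumes "linear A"
  shows "linear (half_iter A n)"
proof (induction n)
  case (Suc n)
  show ?case
    by (rule linearI)
      (simp_all add: linear_add[OF assms] linear_add[OF Suc] linear_scale[OF assms]
        linear_scale[OF Suc] algebra_simps)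
qed (auto intro!: linearI)

text \<open>The iterates are polynomials in \<open>A\<close>. They therefore commute with each
  other, and in the limit the commutation carries over to the square root.\<close>

lemma half_iter_commute:
  assumes "linear S" and "\<And>x. S (A x) = A (S x)"
  shows "S (half_iter A n x) = half_iter A n (S x)"
  by (induction n arbitrary: x)
    (simp_all add: linear_0[OF assms(1)] linear_add[OF assms(1)] linear_scale[OF assms(1)] assms(2))

lemma half_iter_symmetric:
  assumes "\<And>x y. inner (A x) y = inner x (A y)"
  shows "inner (half_iter A n x) y = inner x (half_iter A n y)"
  by (induction n arbitrary: x y) (simp_all add: inner_add_left inner_add_right assms)

primrec half_iter_bound :: "nat \<Rightarrow> real" where
  "half_iter_bound 0 = 0"
| "half_iter_bound (Suc n) = (1 + (half_iter_bound n)\<^sup>2) / 2"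

lemma half_iter_bound_range: "0 \<le> half_iter_bound n \<and> half_iter_bound n \<le> 1"
  by (induction n) (auto simp: power_le_one)

text \<open>The gap equals \<open>(half_iter_bound n - 1)\<^sup>2 / 2\<close>.\<close>

lemma half_iter_bound_Suc: "half_iter_bound n \<le> half_iter_bound (Suc n)"
  using zero_le_power2[of "half_iter_bound n - 1"] by (simp add: power2_eq_square algebra_simps)

lemma norm_half_iter:
  assumes "\<And>x. norm (A x) \<le> norm x"
  shows "norm (half_iter A n x) \<le> half_iter_bound n * norm x"
proof (induction n arbitrary: x)
  case (Suc n)
  have "norm (half_iter A n (half_iter A n x)) \<le> half_iter_bound n * (half_iter_bound n * norm x)"
    using half_iter_bound_range[of n] by (intro order.trans[OF Suc] mult_left_mono Suc) auto
  then have "norm (A x + half_iter A n (half_iter A n x)) \<le> norm x + half_iter_bound n * (half_iter_bound n * norm x)"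
    by (intro order.trans[OF norm_triangle_ineq] add_mono assms)
  then show ?case
    by (simp add: power2_eq_square algebra_simps del: scaleR_add_right)
qed simp

text \<open>
  The increments are polynomials in \<open>A\<close> with nonnegative coefficients, so they are dominated by
  the increments of the scalar iteration, which is the case \<open>A = 1\<close>.
\<close>

lemma norm_half_iter_Suc_diff:
  assumes "linear A" and "\<And>x. norm (A x) \<le> norm x"
  shows "norm (half_iter A (Suc n) x - half_iter A n x)
    \<le> (half_iter_bound (Suc n) - half_iter_bound n) * norm x"
proof (induction n arbitrary: x)
  case 0
  then show ?case using assms(2)[of x] by (simp add: linear_0)
next
  case (Suc n)
  let ?Y = "half_iter A" and ?b = half_iter_bound
  have lin: "linear (?Y m)" for m using linear_half_iter[OF assms(1)] .
  have comm: "?Y m (?Y k x) = ?Y k (?Y m x)" for m k x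
    by (intro half_iter_commute[OF lin] half_iter_commute[OF assms(1), symmetric] refl)
  define d where "d = ?Y (Suc n) x - ?Y n x"
  have d: "norm d \<le> (?b (Suc n) - ?b n) * norm x" unfolding d_def by (rule Suc)
  have "?Y (Suc (Suc n)) x - ?Y (Suc n) x
    = (1/2) *\<^sub>R (?Y (Suc n) (?Y (Suc n) x) - ?Y n (?Y n x))"
    unfolding half_iter.simps(2)[of A "Suc n"] half_iter.simps(2)[of A n]
    by (simp only: scaleR_right_diff_distrib[symmetric] add_diff_cancel_left)
  \<comment> \<open>Difference of squares of two commuting iterates; the scalar sequence factors in
    the same way, which closes the induction.\<close>
  also have "\<dots> = (1/2) *\<^sub>R (?Y (Suc n) d + ?Y n d)"
    unfolding d_def by (simp only: linear_diff[OF lin] comm[of n "Suc n"], simp only: algebra_simps)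
  finally have "norm (?Y (Suc (Suc n)) x - ?Y (Suc n) x) = (1/2) * norm (?Y (Suc n) d + ?Y n d)"
    by (simp only: norm_scaleR)
  also have "\<dots> \<le> (1/2) * (?b (Suc n) * norm d + ?b n * norm d)"
    by (intro mult_left_mono order.trans[OF norm_triangle_ineq] add_mono norm_half_iter assms(2)) simp
  also have "\<dots> = (1/2) * (?b (Suc n) + ?b n) * norm d" by (simp only: algebra_simps)
  also have "\<dots> \<le> (1/2) * (?b (Suc n) + ?b n) * ((?b (Suc n) - ?b n) * norm x)"
    using half_iter_bound_range[of n] half_iter_bound_range[of "Suc n"]
    by (intro mult_left_mono d) auto
  also have "\<dots> = (?b (Suc (Suc n)) - ?b (Suc n)) * norm x"
    unfolding half_iter_bound.simps(2)[of "Suc n"] half_iter_bound.simps(2)[of n]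
    by (simp add: power2_eq_square field_simps)
  finally show ?case .
qed

text \<open>Telescoping. Since the scalar sequence is increasing and bounded, this estimate makes
  the iterates Cauchy at each point.\<close>

lemma norm_half_iter_diff:
  assumes "linear A" and "\<And>x. norm (A x) \<le> norm x"
  shows "norm (half_iter A (n + k) x - half_iter A n x)
    \<le> (half_iter_bound (n + k) - half_iter_bound n) * norm x"
proof (induction k)
  case (Suc k)
  have "norm (half_iter A (n + Suc k) x - half_iter A n x)
    \<le> norm (half_iter A (Suc (n + k)) x - half_iter A (n + k) x) + norm (half_iter A (n + k) x - half_iter A n x)"
    using norm_triangle_ineq[of "half_iter A (Suc (n + k)) x - half_iter A (n + k) x"
        "half_iter A (n + k) x - half_iter A n x"] by simp
  also have "\<dots> \<le> (half_iter_bound (Suc (n + k)) - half_iter_bound (n + k)) * norm x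
      + (half_iter_bound (n + k) - half_iter_bound n) * norm x"
    by (intro add_mono norm_half_iter_Suc_diff[OF assms] Suc)
  finally show ?case by (simp only: add_Suc_right algebra_simps)
qed simp

lemma convergent_half_iter:
  fixes A :: "'h::{real_inner, complete_space} \<Rightarrow> 'h"
  assumes "linear A" and "\<And>x. norm (A x) \<le> norm x"
  shows "convergent (\<lambda>n. half_iter A n x)"
proof -
  have "incseq half_iter_bound" by (rule incseq_SucI half_iter_bound_Suc)+
  moreover have "bdd_above (range half_iter_bound)"
    using half_iter_bound_range by (auto intro!: bdd_aboveI2[where M = 1])
  ultimately have "Cauchy half_iter_bound"
    using LIMSEQ_incseq_SUP LIMSEQ_imp_Cauchy by blast
  then have "Cauchy (\<lambda>n. half_iter_bound n * norm x)"
    by (simp add: Cauchy_convergent_iff convergent_mult convergent_const)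
  have "Cauchy (\<lambda>n. half_iter A n x)"
    unfolding Cauchy_altdef
  proof (intro allI impI)
    fix e :: real assume "e > 0"
    with \<open>Cauchy (\<lambda>n. half_iter_bound n * norm x)\<close>
    obtain M where M: "\<And>m n. M \<le> m \<Longrightarrow> m < n \<Longrightarrow> dist (half_iter_bound m * norm x) (half_iter_bound n * norm x) < e"
      unfolding Cauchy_altdef by blast
    have "dist (half_iter A m x) (half_iter A n x) < e" if mn: "M \<le> m" "m < n" for m n
    proof -
      obtain k where k: "n = m + k" using less_imp_add_positive[OF mn(2)] by blast
      have "norm (half_iter A n x - half_iter A m x) \<le> (half_iter_bound n - half_iter_bound m) * norm x"
        unfolding k by (rule norm_half_iter_diff[OF assms])
      also have "\<dots> \<le> dist (half_iter_bound m * norm x) (half_iter_bound n * norm x)"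
        by (simp add: dist_real_def algebra_simps)
      also have "\<dots> < e" using M[OF mn] .
      finally show ?thesis by (simp add: dist_norm norm_minus_commute)
    qed
    then show "\<exists>M. \<forall>m\<ge>M. \<forall>n>m. dist (half_iter A m x) (half_iter A n x) < e" by blast
  qed
  then show ?thesis by (rule Cauchy_convergent)
qed

text \<open>
  The limit \<open>Y\<close> of the iteration satisfies \<open>2Y = A + Y\<^sup>2\<close>, that is \<open>(1 - Y)\<^sup>2 = 1 - A\<close>.
\<close>

lemma contraction_sqrt_exists:
  fixes A :: "'h::{real_inner, complete_space} \<Rightarrow> 'h"
  assumes lin: "linear A" and contr: "\<And>x. norm (A x) \<le> norm x"
    and sym: "\<And>x y. inner (A x) y = inner x (A y)"
  obtains S where "pos_sym S" and "bounded_linear S" and "\<And>x. S (S x) = x - A x"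
    and "\<And>R x. bounded_linear R \<Longrightarrow> (\<And>x. R (A x) = A (R x)) \<Longrightarrow> R (S x) = S (R x)"
proof -
  define Y where "Y x = lim (\<lambda>n. half_iter A n x)" for x
  have Y: "(\<lambda>n. half_iter A n x) \<longlonglongrightarrow> Y x" for x
    using convergent_half_iter[OF lin contr] unfolding Y_def convergent_LIMSEQ_iff .
  note linY = linear_half_iter[OF lin]
  have norm_iter: "norm (half_iter A n x) \<le> norm x" for n x
    using norm_half_iter[OF contr, of n x] half_iter_bound_range[of n]
      mult_right_mono[of "half_iter_bound n" 1 "norm x"] by force
  have normY: "norm (Y x) \<le> norm x" for x
    by (rule tendsto_upperbound[OF tendsto_norm[OF Y]]) (simp_all add: norm_iter)
  have Y_add: "Y (x + y) = Y x + Y y" for x y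
    using LIMSEQ_unique[OF Y[of "x + y"]] tendsto_add[OF Y[of x] Y[of y]]
    by (simp add: linear_add[OF linY])
  have Y_scale: "Y (r *\<^sub>R x) = r *\<^sub>R Y x" for r x
    using LIMSEQ_unique[OF Y[of "r *\<^sub>R x"]] tendsto_scaleR[OF tendsto_const Y[of x]]
    by (simp add: linear_scale[OF linY])
  have Y_sym: "inner (Y x) y = inner x (Y y)" for x y
    using LIMSEQ_unique[OF tendsto_inner[OF Y[of x] tendsto_const[of y]]]
      tendsto_inner[OF tendsto_const[of x] Y[of y]]
    by (simp add: half_iter_symmetric[OF sym])
  \<comment> \<open>Pointwise limits need not pass through a composition; here the bound
    \<open>norm_iter\<close>, uniform in \<open>n\<close>, sends
    \<open>half_iter A n (half_iter A n x - Y x)\<close> to \<open>0\<close>.\<close>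
  have Y_Y: "(\<lambda>n. half_iter A n (half_iter A n x)) \<longlonglongrightarrow> Y (Y x)" for x
  proof -
    have "(\<lambda>n. half_iter A n (half_iter A n x - Y x)) \<longlonglongrightarrow> 0"
      using Y[of x] by (intro Lim_null_comparison[OF always_eventually[OF allI[OF norm_iter]]])
        (simp add: LIM_zero tendsto_norm_zero)
    from tendsto_add[OF this Y[of "Y x"]] show ?thesis
      by (simp add: linear_diff[OF linY])
  qed
  have fixpoint: "Y x = (1/2) *\<^sub>R (A x + Y (Y x))" for x
    by (rule LIMSEQ_unique[OF LIMSEQ_Suc[OF Y]])
      (simp only: half_iter.simps, intro tendsto_intros Y_Y)
  define S where "S x = x - Y x" for x
  have linS: "linear S"
    by (rule linearI) (simp_all add: S_def Y_add Y_scale algebra_simps)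
  have "inner (Y x) x \<le> inner x x" for x
    using norm_cauchy_schwarz[of "Y x" x] mult_right_mono[OF normY, of "norm x" x]
    by (simp add: power2_norm_eq_inner[symmetric] power2_eq_square)
  then have "pos_sym S"
    unfolding pos_sym_def using linS by (simp add: S_def inner_diff_left inner_diff_right Y_sym)
  moreover have "bounded_linear S"
  proof (rule bounded_linear_intro[where K = 2])
    show "norm (S x) \<le> norm x * 2" for x
      using norm_triangle_ineq4[of x "Y x"] normY[of x] by (simp add: S_def)
  qed (simp_all add: linear_add[OF linS] linear_scale[OF linS])
  moreover have "S (S x) = x - A x" for x
  proof -
    have "S (S x) = x - 2 *\<^sub>R Y x + Y (Y x)"
      using Y_add[of "x - Y x" "Y x"] by (simp add: S_def scaleR_2 algebra_simps)
    also have "2 *\<^sub>R Y x = A x + Y (Y x)" by (subst fixpoint) simp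
    finally show ?thesis by simp
  qed
  moreover have "R (S x) = S (R x)" if R: "bounded_linear R" "\<And>x. R (A x) = A (R x)" for R x
  proof -
    have "(\<lambda>n. R (half_iter A n x)) \<longlonglongrightarrow> R (Y x)"
      using bounded_linear.tendsto[OF R(1) Y] .
    then have "R (Y x) = Y (R x)"
      using LIMSEQ_unique[OF Y[of "R x"]]
      by (simp add: half_iter_commute[where A = A and S = R, OF bounded_linear.linear[OF R(1)] R(2)])
    then show ?thesis by (simp add: S_def linear_diff[OF bounded_linear.linear[OF R(1)]])
  qed
  ultimately show thesis using that by blast
qed

text \<open>If \<open>B\<close> bounds the form of \<open>Q\<close>, then
  \<open>A = 1 - Q / B\<close> is a contraction, because \<open>pos_sym_norm_le\<close> absorbs the
  quadratic term; a root of \<open>1 - A = Q / B\<close> is then scaled by \<open>sqrt B\<close>.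
  The commutation clause serves both scalar linearity and uniqueness of the root.\<close>

lemma pos_sym_sqrt_exists:
  fixes Q :: "'h::{real_inner, complete_space} \<Rightarrow> 'h"
  assumes Q: "pos_sym Q" "bounded_linear Q"
  obtains S where "pos_sym S" and "bounded_linear S" and "\<And>x. S (S x) = Q x"
    and "\<And>R x. bounded_linear R \<Longrightarrow> (\<And>x. R (Q x) = Q (R x)) \<Longrightarrow> R (S x) = S (R x)"
proof -
  note linQ = pos_symD(1)[OF Q(1)]
  obtain B where B: "0 < B" "\<And>x. inner (Q x) x \<le> B * (norm x)\<^sup>2"
    using bounded_linear_inner_le[OF Q(2)] by blast
  define A where "A x = x - (1 / B) *\<^sub>R Q x" for x
  have linA: "linear A"
    by (rule linearI) (simp_all add: A_def linear_add[OF linQ] linear_scale[OF linQ] algebra_simps)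
  have "norm (A x) \<le> norm x" for x
  proof -
    have "(norm (A x))\<^sup>2 = (norm x)\<^sup>2 - (2 / B) * inner (Q x) x + (1 / B)\<^sup>2 * (norm (Q x))\<^sup>2"
      unfolding power2_norm_eq_inner A_def
      by (simp add: inner_diff_left inner_diff_right inner_commute power2_eq_square)
    also have "\<dots> \<le> (norm x)\<^sup>2 - (2 / B) * inner (Q x) x + (1 / B)\<^sup>2 * (B * inner (Q x) x)"
      by (intro add_left_mono mult_left_mono pos_sym_norm_le[OF Q(1)] B(2)) simp
    also have "\<dots> = (norm x)\<^sup>2 - (1 / B) * inner (Q x) x"
      using B(1) by (simp add: power2_eq_square field_simps)
    also have "\<dots> \<le> (norm x)\<^sup>2"
      using B(1) pos_symD(3)[OF Q(1), of x] by simp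
    finally show ?thesis by (rule power2_le_imp_le) simp
  qed
  moreover have "inner (A x) y = inner x (A y)" for x y
    by (simp add: A_def inner_diff_left inner_diff_right pos_symD(2)[OF Q(1)])
  ultimately obtain S where S: "pos_sym S" "bounded_linear S" "\<And>x. S (S x) = x - A x"
    "\<And>R x. bounded_linear R \<Longrightarrow> (\<And>x. R (A x) = A (R x)) \<Longrightarrow> R (S x) = S (R x)"
    using contraction_sqrt_exists[OF linA] by blast
  define S' where "S' x = sqrt B *\<^sub>R S x" for x
  have "bounded_linear S'"
    unfolding S'_def using S(2) by (rule bounded_linear_scaleR_right[THEN bounded_linear_compose])
  moreover from this have "pos_sym S'"
    using B(1) pos_symD[OF S(1)]
    unfolding pos_sym_def by (auto simp: S'_def intro: bounded_linear.linear)
  moreover have "S' (S' x) = Q x" for x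
    using B(1) by (simp add: S'_def S(3) linear_scale[OF pos_symD(1)[OF S(1)]] A_def)
  moreover have "R (S' x) = S' (R x)" if R: "bounded_linear R" "\<And>x. R (Q x) = Q (R x)" for R x
  proof -
    note linR = bounded_linear.linear[OF R(1)]
    have "R (A x) = A (R x)" for x
      by (simp add: A_def linear_diff[OF linR] linear_scale[OF linR] R(2))
    then show ?thesis by (simp add: S'_def linear_scale[OF linR] S(4)[OF R(1)])
  qed
  ultimately show thesis using that by blast
qed

text \<open>Commuting gives \<open>(S + T) (S - T) = 0\<close>, so at \<open>y = S x - T x\<close>
  two nonnegative numbers add up to zero and \<open>S y = T y = 0\<close>. Symmetry then turns
  \<open>inner y y\<close> into \<open>inner x (S y) - inner x (T y)\<close>.\<close>

lemma pos_sym_sqrt_unique: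
  assumes S: "pos_sym S" "bounded_linear S" and T: "pos_sym T" "bounded_linear T"
    and square: "\<And>x. S (S x) = T (T x)" and comm: "\<And>x. T (S x) = S (T x)"
  shows "S = T"
proof
  fix x
  note linS = pos_symD(1)[OF S(1)] and linT = pos_symD(1)[OF T(1)]
  define y where "y = S x - T x"
  have "S y + T y = 0"
    by (simp add: y_def linear_diff[OF linS] linear_diff[OF linT] square comm)
  then have "inner (S y) y + inner (T y) y = 0"
    by (simp add: inner_add_left[symmetric])
  with pos_symD(3)[OF S(1), of y] pos_symD(3)[OF T(1), of y]
  have "inner (S y) y = 0" "inner (T y) y = 0" by auto
  then have "S y = 0" "T y = 0"
    using pos_sym_eq_zero S T by blast+
  have "inner y y = inner x (S y) - inner x (T y)"
    unfolding pos_symD(2)[OF S(1), symmetric] pos_symD(2)[OF T(1), symmetric]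
    by (simp add: y_def inner_diff_left)
  then have "inner y y = 0" by (simp add: \<open>S y = 0\<close> \<open>T y = 0\<close>)
  then show "S x = T x" by (simp add: y_def)
qed

section \<open>The Riesz representation theorem\<close>

text \<open>
  The representing vector minimizes \<open>(norm x)\<^sup>2 / 2 - \<phi> x\<close>: minimizing sequences are Cauchy by the
  parallelogram law.
\<close>

lemma riesz_real:
  fixes \<phi> :: "'h::{real_inner, complete_space} \<Rightarrow> real"
  assumes "bounded_linear \<phi>"
  obtains z where "\<And>x. \<phi> x = inner x z"
proof -
  note lin = bounded_linear.linear[OF assms]
  obtain K where K: "\<And>x. norm (\<phi> x) \<le> norm x * K"
    using bounded_linear.bounded[OF assms] by auto
  define J where "J x = (norm x)\<^sup>2 / 2 - \<phi> x" for x
  \<comment> \<open>Since \<open>\<phi> x \<le> K * norm x\<close>, completing the square bounds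
    \<open>J\<close> from below.\<close>
  have "- K\<^sup>2 / 2 \<le> J x" for x
    using K[of x] zero_le_power2[of "norm x - K"]
    by (simp add: J_def power2_eq_square algebra_simps abs_le_iff)
  then have bdd: "bdd_below (range J)" by (rule bdd_belowI2)
  define m where "m = Inf (range J)"
  have m_le: "m \<le> J x" for x unfolding m_def using bdd by (simp add: cInf_lower)
  have "\<exists>x. J x < m + inverse (real (Suc n))" for n
    using cInf_lessD[of "range J" "m + inverse (real (Suc n))"] by (auto simp: m_def)
  then obtain u where u: "\<And>n. J (u n) < m + inverse (real (Suc n))" by metis
  have parallelogram: "(norm (x - y))\<^sup>2 / 4 \<le> J x + J y - 2 * m" for x y
  proof -
    have "(norm (x - y))\<^sup>2 / 4 = J x + J y - 2 * J ((1/2) *\<^sub>R (x + y))"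
      by (simp only: J_def linear_add[OF lin] linear_scale[OF lin] norm_scaleR power_mult_distrib)
        (simp add: power2_norm_eq_inner inner_diff_left inner_diff_right inner_add_left inner_add_right
          inner_commute field_simps)
    with m_le[of "(1/2) *\<^sub>R (x + y)"] show ?thesis by simp
  qed
  have "Cauchy u"
  proof (rule metric_CauchyI)
    fix e :: real assume "e > 0"
    \<comment> \<open>Two errors below \<open>e\<^sup>2 / 8\<close> add up to less than
      \<open>e\<^sup>2 / 4\<close>, matching the divisor \<open>4\<close> in
      \<open>parallelogram\<close>.\<close>
    then obtain N where N: "inverse (real (Suc N)) < e\<^sup>2 / 8"
      using reals_Archimedean[of "e\<^sup>2 / 8"] by auto
    have "dist (u i) (u j) < e" if "N \<le> i" "N \<le> j" for i j
    proof -
      have "inverse (real (Suc i)) \<le> inverse (real (Suc N))" "inverse (real (Suc j)) \<le> inverse (real (Suc N))"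
        using that by (auto intro!: le_imp_inverse_le)
      then have "(norm (u i - u j))\<^sup>2 < e\<^sup>2"
        using parallelogram[of "u i" "u j"] u[of i] u[of j] N by linarith
      then show ?thesis
        using \<open>e > 0\<close> by (simp add: dist_norm power2_less_imp_less)
    qed
    then show "\<exists>M. \<forall>i\<ge>M. \<forall>j\<ge>M. dist (u i) (u j) < e" by blast
  qed
  then obtain z where z: "u \<longlonglongrightarrow> z"
    using Cauchy_convergent convergent_def by blast
  have "(\<lambda>n. J (u n)) \<longlonglongrightarrow> J z"
    unfolding J_def by (intro tendsto_intros z bounded_linear.tendsto[OF assms]) simp
  moreover have "(\<lambda>n. m + inverse (real (Suc n))) \<longlonglongrightarrow> m + 0"
    by (intro tendsto_add tendsto_const LIMSEQ_inverse_real_of_nat)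
  ultimately have "J z \<le> m"
    using LIMSEQ_le[of "\<lambda>n. J (u n)"] u by (force intro: less_imp_le)
  have "\<phi> x = inner x z" for x
  proof -
    define b c where "b = inner x z - \<phi> x" and "c = (norm x)\<^sup>2 / 2"
    have quadratic: "0 \<le> t * b + t\<^sup>2 * c" for t
    proof -
      have "J z \<le> J (z + t *\<^sub>R x)" using \<open>J z \<le> m\<close> m_le order.trans by blast
      then show ?thesis
        unfolding J_def b_def c_def power2_norm_eq_inner linear_add[OF lin] linear_scale[OF lin]
        by (simp add: inner_add_left inner_add_right inner_commute power2_eq_square algebra_simps)
    qed
    have "c \<ge> 0" by (simp add: c_def)
    \<comment> \<open>Adding \<open>1\<close> keeps the denominator positive when
      \<open>x = 0\<close>; at \<open>- t\<close> the quadratic then equals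
      \<open>- t\<^sup>2\<close>.\<close>
    define t where "t = b / (c + 1)"
    have b: "b = t * (c + 1)" using \<open>c \<ge> 0\<close> by (simp add: t_def)
    have "0 \<le> - t\<^sup>2"
      using quadratic[of "- t"] unfolding b by (simp add: power2_eq_square algebra_simps)
    then have "b = 0" by (simp add: b)
    then show ?thesis by (simp add: b_def)
  qed
  then show thesis using that by blast
qed

section \<open>Hilbert spaces and adjoints\<close>

context hilbert_type
begin

lemma ip_add_right: "ip x (y + z) = ip x y + ip x z"
  by (metis ip_add ip_conjg conjg_add)

text \<open>Both products induce the same norm: expanding the squared norm of \<open>x + y\<close>
  through \<open>ip\<close> and through \<open>inner\<close> isolates the cross terms.\<close>

lemma rc_re_ip: "rc_re (ip x y) = inner x y"
proof -
  have "ip (x + y) (x + y) = ip x x + ip y y + (ip x y + conjg (ip x y))"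
    by (simp add: ip_add ip_add_right ip_conjg[of y x] algebra_simps)
  then have "of_real ((norm (x + y))\<^sup>2) = (of_real ((norm x)\<^sup>2 + (norm y)\<^sup>2 + 2 * rc_re (ip x y)) :: 'k)"
    unfolding ip_self add_conjg of_real_add .
  then have "(norm (x + y))\<^sup>2 = (norm x)\<^sup>2 + (norm y)\<^sup>2 + 2 * rc_re (ip x y)"
    unfolding of_real_eq_iff .
  then show ?thesis
    by (simp add: power2_norm_eq_inner inner_add_left inner_add_right inner_commute)
qed

lemma ip_right_eqI:
  assumes "\<And>x. ip x y = ip x z"
  shows "y = z"
  by (rule inner_commute[THEN trans, THEN vector_eq_rdot[THEN iffD1, OF allI]])
    (metis assms rc_re_ip inner_commute)

lemma norm_sc: "norm (sc c x) = norm c * norm x"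
proof -
  have "ip x (sc c x) = conjg c * ip x x"
    using ip_conjg[of x "sc c x"] ip_conjg[of x x] by (simp add: ip_sc conjg_mult)
  then have "ip (sc c x) (sc c x) = (c * conjg c) * ip x x" by (simp add: ip_sc)
  then have "of_real ((norm (sc c x))\<^sup>2) = (of_real ((norm c * norm x)\<^sup>2) :: 'k)"
    unfolding ip_self mult_conjg_of_real by (simp add: power_mult_distrib)
  then have "(norm (sc c x))\<^sup>2 = (norm c * norm x)\<^sup>2" unfolding of_real_eq_iff .
  then show ?thesis by (simp add: power2_eq_iff_nonneg)
qed

lemma bounded_linear_sc: "bounded_linear (sc c)"
proof (rule bounded_linear_intro[where K = "norm c"])
  show "sc c (r *\<^sub>R x) = r *\<^sub>R sc c x" for r x
    by (simp add: sc_of_real[symmetric] mult.commute)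
qed (simp_all add: scale_right_distrib norm_sc mult.commute)

text \<open>The vector representing the real part represents \<open>\<phi>\<close> itself: replacing
  \<open>x\<close> by \<open>sc c x\<close> gives the real part of \<open>c * \<phi> x\<close> for
  every \<open>c\<close>, and \<open>rc_scalar_eqI\<close> applies.\<close>

lemma riesz:
  assumes add: "\<And>x y. \<phi> (x + y) = \<phi> x + \<phi> y" and scale: "\<And>c x. \<phi> (sc c x) = c * \<phi> x"
    and bound: "\<And>x. norm (\<phi> x) \<le> K * norm x"
  shows "\<exists>!z. \<forall>x. \<phi> x = ip x z"
proof -
  have "bounded_linear (\<lambda>x. rc_re (\<phi> x))"
  proof (rule bounded_linear_intro[where K = K])
    show "rc_re (\<phi> (r *\<^sub>R x)) = r *\<^sub>R rc_re (\<phi> x)" for r x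
      by (simp add: sc_of_real[symmetric] scale rc_re_of_real_mult)
    show "norm (rc_re (\<phi> x)) \<le> norm x * K" for x
      using abs_rc_re_le_norm[of "\<phi> x"] bound[of x] by (simp add: mult.commute)
  qed (simp add: add rc_re_add)
  then obtain z where z: "\<And>x. rc_re (\<phi> x) = inner x z" using riesz_real by blast
  have "\<phi> x = ip x z" for x
    by (rule rc_scalar_eqI) (simp add: scale[symmetric] ip_sc[symmetric] z rc_re_ip)
  then show ?thesis using ip_right_eqI by metis
qed

text \<open>The hypotheses concern only the functional sending \<open>x\<close> to
  \<open>ip' (T x) y\<close>, so that the codomain may be a whole type or a carrier set.\<close>

lemma ip_adj:
  assumes "\<And>x x'. ip' (T (x + x')) y = ip' (T x) y + ip' (T x') y"
    and "\<And>c x. ip' (T (sc c x)) y = c * ip' (T x) y"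
    and "\<And>x. norm (ip' (T x) y) \<le> K * norm x"
  shows "ip x (adj ip ip' T y) = ip' (T x) y"
proof -
  have "\<forall>x. ip' (T x) y = ip x (adj ip ip' T y)"
    unfolding adj_def by (rule theI'[OF riesz]) (fact assms)+
  then show ?thesis by simp
qed

text \<open>Multiplying \<open>x\<close> by \<open>conjg (ip x y)\<close> makes the inner product
  real and nonnegative, which reduces the claim to the real inequality.\<close>

lemma norm_ip_le: "norm (ip x y) \<le> norm x * norm y"
proof (cases "ip x y = 0")
  case False
  define c where "c = conjg (ip x y)"
  have "(norm (ip x y))\<^sup>2 = rc_re (ip (sc c x) y)"
    by (simp add: c_def ip_sc mult.commute[of "conjg _"] mult_conjg_of_real del: of_real_power)
  also have "\<dots> \<le> norm (sc c x) * norm y"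
    unfolding rc_re_ip by (rule norm_cauchy_schwarz)
  also have "\<dots> = norm (ip x y) * (norm x * norm y)" by (simp add: norm_sc c_def)
  finally show ?thesis using False by (simp add: power2_eq_square)
qed simp

section \<open>Adjoints, positive operators and their square roots over the scalar field\<close>

lemma ip_adj_bounded_op:
  assumes "bounded_op sc T"
  shows "ip x (adj ip ip T y) = ip (T x) y"
proof -
  have T: "bounded_linear T" "\<And>c x. T (sc c x) = sc c (T x)"
    using assms by (auto simp: bounded_op_def)
  obtain K where K: "\<And>x. norm (T x) \<le> norm x * K"
    using bounded_linear.bounded[OF T(1)] by auto
  show ?thesis
  proof (rule ip_adj)
    show "norm (ip (T x) y) \<le> (K * norm y) * norm x" for x
      using order.trans[OF norm_ip_le mult_right_mono[OF K], of y x] by (simp add: mult_ac)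
  qed (simp_all add: linear_add[OF bounded_linear.linear[OF T(1)]] T(2) ip_add ip_sc)
qed

text \<open>This allows square roots to be built over the real structure. Real symmetry tested on
  all multiples \<open>sc c x\<close> gives self-adjointness for \<open>ip\<close>; then
  \<open>ip (P x) x\<close> is its own conjugate, hence real.\<close>

lemma positive_op_iff:
  "positive_op sc ip P \<longleftrightarrow> bounded_op sc P \<and> pos_sym P"
proof (intro iffI conjI)
  assume P: "positive_op sc ip P"
  then show bdd: "bounded_op sc P" by (simp add: positive_op_def)
  have adj: "adj ip ip P = P" using P by (simp add: positive_op_def)
  have "inner (P x) y = inner x (P y)" for x y
    using ip_adj_bounded_op[OF bdd, of x y] by (simp add: adj flip: rc_re_ip)
  moreover have "0 \<le> inner (P x) x" for x
    using P unfolding positive_op_def rc_re_ip[symmetric] by (metis rc_re_of_real)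
  ultimately show "pos_sym P"
    using bdd by (simp add: pos_sym_def bounded_op_def bounded_linear.linear)
next
  assume asm: "bounded_op sc P \<and> pos_sym P"
  then have bdd: "bounded_op sc P" and pos: "pos_sym P" by auto
  have selfadj: "ip (P x) y = ip x (P y)" for x y
  proof (rule rc_scalar_eqI)
    fix c
    have "inner (P (sc c x)) y = inner (sc c x) (P y)" using pos_symD(2)[OF pos] .
    then show "rc_re (c * ip (P x) y) = rc_re (c * ip x (P y))"
      using bdd by (simp add: bounded_op_def flip: ip_sc rc_re_ip)
  qed
  have "adj ip ip P y = P y" for y
    by (rule ip_right_eqI) (simp add: ip_adj_bounded_op[OF bdd] selfadj)
  moreover have "ip (P x) x = of_real (inner (P x) x)" for x
  proof -
    have "ip (P x) x + conjg (ip (P x) x) = 2 * ip (P x) x"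
      using selfadj[of x x] ip_conjg[of x "P x"] by simp
    then have "2 * ip (P x) x = 2 * of_real (inner (P x) x)"
      unfolding add_conjg rc_re_ip by simp
    then have "of_real 2 * ip (P x) x = of_real 2 * of_real (inner (P x) x)" by simp
    then show ?thesis unfolding mult_cancel_left of_real_eq_0_iff by simp
  qed
  ultimately show "positive_op sc ip P"
    unfolding positive_op_def using bdd pos_symD(3)[OF pos] by blast
qed

lemma ip_positive_op:
  assumes "positive_op sc ip P"
  shows "ip (P x) x = of_real (inner (P x) x)"
  using assms unfolding positive_op_def rc_re_ip[symmetric] by (metis rc_re_of_real)

text \<open>The constructed root commutes with every bounded operator that commutes with
  \<open>P\<close>: with \<open>sc c\<close>, which gives scalar linearity, and with any positive
  root \<open>T\<close>, since \<open>T\<close> commutes with \<open>P = T \<circ> T\<close>, which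
  gives uniqueness.\<close>

lemma op_sqrt:
  assumes "positive_op sc ip P"
  shows "positive_op sc ip (op_sqrt sc ip P)" and "op_sqrt sc ip P (op_sqrt sc ip P x) = P x"
proof -
  have P: "bounded_linear P" "\<And>c x. P (sc c x) = sc c (P x)" "pos_sym P"
    using assms by (auto simp: positive_op_iff bounded_op_def)
  obtain S where S: "pos_sym S" "bounded_linear S" "\<And>x. S (S x) = P x"
    "\<And>R x. bounded_linear R \<Longrightarrow> (\<And>x. R (P x) = P (R x)) \<Longrightarrow> R (S x) = S (R x)"
    using pos_sym_sqrt_exists[OF P(3,1)] by blast
  have "S (sc c x) = sc c (S x)" for c x
    using S(4)[OF bounded_linear_sc] P(2) by metis
  then have "positive_op sc ip S \<and> S \<circ> S = P"
    using S by (auto simp: positive_op_iff bounded_op_def)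
  moreover have "T = S" if T: "positive_op sc ip T \<and> T \<circ> T = P" for T
  proof -
    have T': "bounded_linear T" "pos_sym T" and TT: "\<And>x. T (T x) = P x"
      using T by (auto simp: positive_op_iff bounded_op_def)
    have "T (P x) = P (T x)" for x by (simp flip: TT)
    from S(4)[OF T'(1) this] have "S = T"
      using S T' TT by (intro pos_sym_sqrt_unique) auto
    then show ?thesis ..
  qed
  ultimately have "positive_op sc ip (op_sqrt sc ip P) \<and> op_sqrt sc ip P \<circ> op_sqrt sc ip P = P"
    unfolding op_sqrt_def by (rule theI)
  then show "positive_op sc ip (op_sqrt sc ip P)" "op_sqrt sc ip P (op_sqrt sc ip P x) = P x"
    by (auto simp: fun_eq_iff)
qed

lemma norm_op_sqrt:
  assumes "positive_op sc ip P"
  shows "(norm (op_sqrt sc ip P x))\<^sup>2 = inner (P x) x"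
proof -
  have "pos_sym (op_sqrt sc ip P)"
    using op_sqrt(1)[OF assms] by (simp add: positive_op_iff)
  then show ?thesis
    by (simp add: power2_norm_eq_inner pos_symD(2) inner_commute op_sqrt(2)[OF assms])
qed

end

section \<open>Hilbert spaces on a carrier set, and adjoints of operators into them\<close>

lemma hilbert_spaceD:
  assumes "hilbert_space X" "x \<in> carrier X" "y \<in> carrier X" "z \<in> carrier X"
  shows "x \<oplus>\<^bsub>X\<^esub> y \<in> carrier X" and "c \<odot>\<^bsub>X\<^esub> x \<in> carrier X"
    and "hip X (x \<oplus>\<^bsub>X\<^esub> y) z = hip X x z + hip X y z"
    and "hip X (c \<odot>\<^bsub>X\<^esub> x) z = c * hip X x z"
    and "hip X y x = conjg (hip X x y)"
proof -
  have mod: "Module.module scalar_ring X" using assms(1) by (simp add: hilbert_space_def)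
  interpret X: abelian_group X using mod by (simp add: Module.module_def)
  show "x \<oplus>\<^bsub>X\<^esub> y \<in> carrier X" using assms by simp
  show "c \<odot>\<^bsub>X\<^esub> x \<in> carrier X"
    using Module.module.smult_closed[OF mod, of c x] assms by (simp add: scalar_ring_def)
qed (use assms in \<open>unfold hilbert_space_def, blast+\<close>)

lemma hip_zero_left:
  assumes "hilbert_space X" "z \<in> carrier X"
  shows "hip X \<zero>\<^bsub>X\<^esub> z = 0"
proof -
  interpret X: abelian_group X
    using assms(1) by (simp add: hilbert_space_def Module.module_def)
  show ?thesis
    using hilbert_spaceD(3)[OF assms(1) X.zero_closed X.zero_closed assms(2)] by simp
qed

text \<open>The positivity axiom speaks of nonzero vectors only; the zero vector is covered by
  additivity.\<close>

lemma hip_self_nonneg: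
  assumes "hilbert_space X" "x \<in> carrier X"
  obtains r where "0 \<le> r" and "hip X x x = of_real r" and "r = 0 \<Longrightarrow> x = \<zero>\<^bsub>X\<^esub>"
proof (cases "x = \<zero>\<^bsub>X\<^esub>")
  case True
  then show thesis using that[of 0] hip_zero_left[OF assms] by simp
next
  case False
  then obtain r where "r > 0" "hip X x x = of_real r"
    using assms unfolding hilbert_space_def by blast
  then show thesis using that[of r] by simp
qed

text \<open>For \<open>s > 0\<close>, \<open>w\<close> is \<open>x\<close> minus its component along
  \<open>y\<close>, hence orthogonal to \<open>y\<close>, and \<open>hip X w w = r - n / s\<close>
  must be nonnegative. The case \<open>s = 0\<close> forces \<open>y\<close> to be zero.\<close>

lemma norm_hip_le:
  assumes X: "hilbert_space X" and x: "x \<in> carrier X" and y: "y \<in> carrier X"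
  shows "norm (hip X x y) \<le> hnorm X x * hnorm X y"
proof -
  obtain r where r: "0 \<le> r" "hip X x x = of_real r" using hip_self_nonneg[OF X x] by blast
  obtain s where s: "0 \<le> s" "hip X y y = of_real s" "s = 0 \<Longrightarrow> y = \<zero>\<^bsub>X\<^esub>"
    using hip_self_nonneg[OF X y] by blast
  note sesq = hilbert_spaceD[OF X]
  have "(norm (hip X x y))\<^sup>2 \<le> r * s"
  proof (cases "s = 0")
    case True
    then have "hip X x y = 0"
      using hip_zero_left[OF X x] sesq(5)[OF y x x] s(3) by simp
    then show ?thesis using r s by simp
  next
    case False
    define n where "n = (norm (hip X x y))\<^sup>2"
    define c where "c = - hip X x y / of_real s"
    define w where "w = x \<oplus>\<^bsub>X\<^esub> c \<odot>\<^bsub>X\<^esub> y"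
    have cy: "c \<odot>\<^bsub>X\<^esub> y \<in> carrier X" and w: "w \<in> carrier X"
      unfolding w_def using sesq(1,2) x y by blast+
    have hip_w: "hip X w z = hip X x z + c * hip X y z" if "z \<in> carrier X" for z
      unfolding w_def using sesq(3)[OF x cy that] sesq(4)[OF y y that] by simp
    have "hip X w y = 0"
      using False by (simp add: hip_w[OF y] s(2) c_def)
    then have "hip X y w = 0" using sesq(5)[OF w y y] by simp
    moreover have "hip X w x = of_real (r - n / s)"
      using mult_conjg_of_real[of "hip X x y"] False
      by (simp add: hip_w[OF x] r(2) c_def sesq(5)[OF x y y] n_def field_simps)
    then have "hip X x w = of_real (r - n / s)" using sesq(5)[OF w x x] by (simp del: of_real_diff)
    ultimately have "hip X w w = of_real (r - n / s)" by (simp add: hip_w[OF w])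
    moreover obtain t where "0 \<le> t" "hip X w w = of_real t" using hip_self_nonneg[OF X w] by blast
    ultimately have "0 \<le> r - n / s" by (metis of_real_eq_iff)
    then show ?thesis using False s(1) by (simp add: n_def field_simps)
  qed
  also have "\<dots> = (hnorm X x * hnorm X y)\<^sup>2"
    using r s by (simp add: hnorm_def power_mult_distrib)
  finally show ?thesis
    by (rule power2_le_imp_le) (simp add: hnorm_def)
qed

context hilbert_type
begin

lemma ip_adj_bounded_op_to:
  assumes X: "hilbert_space X" and T: "bounded_op_to sc X T" and y: "y \<in> carrier X"
  shows "ip x (adj ip (hip X) T y) = hip X (T x) y"
proof -
  obtain M where M: "\<And>x. hnorm X (T x) \<le> M * norm x"
    using T by (auto simp: bounded_op_to_def)
  have T': "T x \<in> carrier X" "T (x + x') = T x \<oplus>\<^bsub>X\<^esub> T x'" "T (sc c x) = c \<odot>\<^bsub>X\<^esub> T x" for x x' c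
    using T by (auto simp: bounded_op_to_def)
  show ?thesis
  proof (rule ip_adj)
    show "norm (hip X (T x) y) \<le> (M * hnorm X y) * norm x" for x
      using order.trans[OF norm_hip_le[OF X T'(1) y] mult_right_mono[OF M], of x]
      by (simp add: hnorm_def mult_ac)
    show "hip X (T (x + x')) y = hip X (T x) y + hip X (T x') y" for x x'
      unfolding T'(2) by (rule hilbert_spaceD(3)[OF X T'(1) T'(1) y])
    show "hip X (T (sc c x)) y = c * hip X (T x) y" for c x
      unfolding T'(3) by (rule hilbert_spaceD(4)[OF X T'(1) y y])
  qed
qed

text \<open>The adjoints are moved out of the second argument, so the computation starts from
  \<open>ip g\<close> and is conjugated at the end. For \<open>g = f\<close> it identifies the
  Bessel terms with the quadratic form of \<open>ctrl_op\<close>.\<close>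

lemma ip_ctrl_op:
  assumes X: "hilbert_space (X i)" and C: "bounded_op sc C" and \<Lambda>: "bounded_op_to sc (X i) (\<Lambda> i)"
  shows "ip (ctrl_op ip X C C' \<Lambda> i f) g = hip (X i) (\<Lambda> i (C' f)) (\<Lambda> i (C g))"
proof -
  have carrier: "\<Lambda> i x \<in> carrier (X i)" for x using \<Lambda> by (simp add: bounded_op_to_def)
  have "ip g (ctrl_op ip X C C' \<Lambda> i f) = hip (X i) (\<Lambda> i (C g)) (\<Lambda> i (C' f))"
    unfolding ctrl_op_def ip_adj_bounded_op[OF C] ip_adj_bounded_op_to[OF X \<Lambda> carrier] ..
  then show ?thesis
    using ip_conjg[of "ctrl_op ip X C C' \<Lambda> i f" g] hilbert_spaceD(5)[OF X carrier carrier carrier]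
    by metis
qed

end

section \<open>Families of positive operators\<close>

text \<open>The Cauchy criterion for the net of finite partial sums: convergence of the sums of
  \<open>a\<close> makes those of \<open>f\<close> over set differences small. The bound then passes
  to the limit.\<close>

lemma summable_on_norm_square_bound:
  fixes f :: "'i \<Rightarrow> 'h::{real_inner, complete_space}"
  assumes a: "a summable_on A" "\<And>i. i \<in> A \<Longrightarrow> 0 \<le> a i"
    and bound: "\<And>F. finite F \<Longrightarrow> F \<subseteq> A \<Longrightarrow> (norm (sum f F))\<^sup>2 \<le> c * sum a F" and "0 \<le> c"
  shows "f summable_on A" and "(norm (infsum f A))\<^sup>2 \<le> c * infsum a A"
proof -
  have sum_a: "(sum a \<longlongrightarrow> infsum a A) (finite_subsets_at_top A)"
    using has_sum_infsum[OF a(1)] by (simp add: has_sum_def)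
  have "\<exists>P. eventually P (finite_subsets_at_top A) \<and>
              (\<forall>F F'. P F \<and> P F' \<longrightarrow> dist (sum f F) (sum f F') < e)" if "e > 0" for e
  proof -
    \<comment> \<open>Taking \<open>c + 1\<close> instead of \<open>c\<close> avoids a zero
      denominator and makes \<open>c * d\<close> strictly less than
      \<open>(e / 2)\<^sup>2\<close>.\<close>
    define d where "d = e\<^sup>2 / (4 * (c + 1))"
    define P where "P F \<longleftrightarrow> (finite F \<and> F \<subseteq> A) \<and> infsum a A - d < sum a F" for F
    have "d > 0" using that \<open>0 \<le> c\<close> by (simp add: d_def)
    have "eventually P (finite_subsets_at_top A)"
      unfolding P_def using order_tendstoD(1)[OF sum_a, of "infsum a A - d"] \<open>d > 0\<close>
      by (intro eventually_conj) (auto intro: eventually_finite_subsets_at_top_weakI)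
    moreover have half: "norm (sum f (F - G)) < e / 2" if "P F" "P G" for F G
    proof -
      have fin: "finite F" "F \<subseteq> A" "finite G" "G \<subseteq> A" using that by (auto simp: P_def)
      \<comment> \<open>The sum over \<open>F \<union> G\<close> cannot exceed the infinite sum, and
        \<open>G\<close> already comes within \<open>d\<close> of it, so at most \<open>d\<close> is
        left for \<open>F - G\<close>.\<close>
      have "sum a (F - G) + sum a G = sum a (F \<union> G)"
        using fin sum.union_disjoint[of "F - G" G a] by (simp add: Diff_disjoint Int_commute)
      also have "\<dots> \<le> infsum a A"
        using fin a by (intro finite_sum_le_infsum) auto
      finally have "sum a (F - G) \<le> d" using that by (simp add: P_def)
      then have "(norm (sum f (F - G)))\<^sup>2 \<le> c * d"
        using bound[of "F - G"] fin mult_left_mono[OF _ \<open>0 \<le> c\<close>] order.trans by blast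
      also have "\<dots> < (c + 1) * d" using \<open>d > 0\<close> by simp
      also have "\<dots> = (e / 2)\<^sup>2" using \<open>0 \<le> c\<close> by (simp add: d_def power_divide field_simps)
      finally show ?thesis by (rule power2_less_imp_less) (use \<open>e > 0\<close> in simp)
    qed
    have "dist (sum f F) (sum f G) < e" if "P F" "P G" for F G
    proof -
      have "finite F" "finite G" using that by (auto simp: P_def)
      then have "sum f F - sum f G = sum f (F - G) - sum f (G - F)"
        using sum.Int_Diff[of F f G] sum.Int_Diff[of G f F] by (simp add: Int_commute)
      then show ?thesis
        using half[OF that] half[OF that(2,1)] norm_triangle_ineq4[of "sum f (F - G)" "sum f (G - F)"]
        by (simp add: dist_norm)
    qed
    ultimately show ?thesis by blast
  qed
  then have "cauchy_filter (filtermap (sum f) (finite_subsets_at_top A))"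
    by (simp add: cauchy_filter_metric_filtermap)
  moreover have "complete (UNIV :: 'h set)"
    by (meson Cauchy_convergent UNIV_I complete_def convergent_def)
  ultimately obtain L where L: "(sum f \<longlongrightarrow> L) (finite_subsets_at_top A)"
    using complete_uniform[where S = "UNIV :: 'h set"] by (force simp add: filterlim_def)
  then have hs: "(f has_sum L) A" by (simp add: has_sum_def)
  then show "f summable_on A" by (auto simp: summable_on_def)
  have "(norm L)\<^sup>2 \<le> c * infsum a A"
    by (rule tendsto_le[OF finite_subsets_at_top_neq_bot tendsto_mult_left[OF sum_a]
          tendsto_power[OF tendsto_norm[OF L]]])
      (auto intro!: eventually_finite_subsets_at_top_weakI bound)
  then show "(norm (infsum f A))\<^sup>2 \<le> c * infsum a A" using infsumI[OF hs] by simp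
qed

lemma pos_sym_sum:
  assumes "\<And>i. i \<in> F \<Longrightarrow> pos_sym (Q i)"
  shows "pos_sym (\<lambda>x. \<Sum>i\<in>F. Q i x)"
  unfolding pos_sym_def inner_sum_left inner_sum_right
  using pos_symD[OF assms] by (auto intro!: linear_compose_sum sum.cong sum_nonneg)

lemma positive_family_summable:
  fixes Q :: "'i \<Rightarrow> 'h::{real_inner, complete_space} \<Rightarrow> 'h"
  assumes Q: "\<And>i. i \<in> A \<Longrightarrow> pos_sym (Q i)" and "0 \<le> B"
    and summable: "\<And>x. (\<lambda>i. inner (Q i x) x) summable_on A"
    and bound: "\<And>x. (\<Sum>\<^sub>\<infinity>i\<in>A. inner (Q i x) x) \<le> B * (norm x)\<^sup>2"
  shows "(\<lambda>i. Q i x) summable_on A"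
    and "(norm (\<Sum>\<^sub>\<infinity>i\<in>A. Q i x))\<^sup>2 \<le> B * (\<Sum>\<^sub>\<infinity>i\<in>A. inner (Q i x) x)"
proof -
  have nonneg: "0 \<le> inner (Q i x) x" if "i \<in> A" for i x using pos_symD(3)[OF Q[OF that]] .
  have "(norm (\<Sum>i\<in>F. Q i x))\<^sup>2 \<le> B * (\<Sum>i\<in>F. inner (Q i x) x)" if F: "finite F" "F \<subseteq> A" for F
  proof -
    \<comment> \<open>The form bound is needed at every \<open>y\<close>, because
      \<open>pos_sym_norm_le\<close> uses it at the partial sum applied to \<open>x\<close>.\<close>
    have "inner (\<Sum>i\<in>F. Q i y) y \<le> B * (norm y)\<^sup>2" for y
      unfolding inner_sum_left using F nonneg
      by (intro order.trans[OF finite_sum_le_infsum[OF summable] bound]) auto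
    then have "(norm (\<Sum>i\<in>F. Q i x))\<^sup>2 \<le> B * inner (\<Sum>i\<in>F. Q i x) x"
      using F Q by (intro pos_sym_norm_le pos_sym_sum) auto
    then show ?thesis by (simp only: inner_sum_left)
  qed
  from summable_on_norm_square_bound[OF summable nonneg this \<open>0 \<le> B\<close>]
  show "(\<lambda>i. Q i x) summable_on A"
    and "(norm (\<Sum>\<^sub>\<infinity>i\<in>A. Q i x))\<^sup>2 \<le> B * (\<Sum>\<^sub>\<infinity>i\<in>A. inner (Q i x) x)" by auto
qed

section \<open>The synthesis operator on square-root families\<close>

lemma synth_sqrt_family:
  assumes "synth_well_defined sc ip I P"
  shows "synth sc ip I P (sqrt_family sc ip I P f) = (\<Sum>\<^sub>\<infinity>i\<in>I. P i f)"
  unfolding synth_def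
proof (rule the_equality)
  show "\<exists>f'. sqrt_family sc ip I P f = sqrt_family sc ip I P f' \<and> (\<Sum>\<^sub>\<infinity>i\<in>I. P i f) = (\<Sum>\<^sub>\<infinity>i\<in>I. P i f')"
    by blast
  show "h = (\<Sum>\<^sub>\<infinity>i\<in>I. P i f)"
    if "\<exists>f'. sqrt_family sc ip I P f = sqrt_family sc ip I P f' \<and> h = (\<Sum>\<^sub>\<infinity>i\<in>I. P i f')" for h
    using that assms unfolding synth_well_defined_def by metis
qed

context hilbert_type
begin

lemma sqrt_family_in_ell2_iff:
  assumes "\<And>i. i \<in> I \<Longrightarrow> positive_op sc ip (P i)"
  shows "sqrt_family sc ip I P f \<in> ell2 I \<longleftrightarrow> (\<lambda>i. inner (P i f) f) summable_on I"
proof -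
  have "(\<lambda>i. (norm (sqrt_family sc ip I P f i))\<^sup>2) summable_on I \<longleftrightarrow> (\<lambda>i. inner (P i f) f) summable_on I"
    by (rule summable_on_cong) (simp add: sqrt_family_def norm_op_sqrt assms)
  then show ?thesis by (simp add: ell2_def sqrt_family_def)
qed

lemma ell2_norm_sqrt_family:
  assumes "\<And>i. i \<in> I \<Longrightarrow> positive_op sc ip (P i)"
  shows "ell2_norm I (sqrt_family sc ip I P f) = sqrt (\<Sum>\<^sub>\<infinity>i\<in>I. inner (P i f) f)"
  unfolding ell2_norm_def
  by (intro arg_cong[where f = sqrt] infsum_cong) (simp add: sqrt_family_def norm_op_sqrt assms)

text \<open>Applying the root once more recovers \<open>P i f\<close>, so equal families give equal
  series term by term.\<close>

lemma sqrt_family_determines: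
  assumes "\<And>i. i \<in> I \<Longrightarrow> positive_op sc ip (P i)"
    and "sqrt_family sc ip I P f = sqrt_family sc ip I P g" and "i \<in> I"
  shows "P i f = P i g"
proof -
  have "op_sqrt sc ip (P i) f = op_sqrt sc ip (P i) g"
    using fun_cong[OF assms(2), of i] assms(3) by (simp add: sqrt_family_def)
  then show ?thesis using op_sqrt(2)[OF assms(1)[OF assms(3)]] by metis
qed

lemma synth_bounded_iff:
  assumes P: "\<And>i. i \<in> I \<Longrightarrow> positive_op sc ip (P i)" and "0 < B"
  shows "(\<forall>f. (\<lambda>i. inner (P i f) f) summable_on I \<and> (\<Sum>\<^sub>\<infinity>i\<in>I. inner (P i f) f) \<le> B * (norm f)\<^sup>2) \<longleftrightarrow>
    synth_well_defined sc ip I P \<and>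
    ell2_bounded_on I (synth_dom sc ip I P) (synth sc ip I P) \<and>
    ell2_onorm_on I (synth_dom sc ip I P) (synth sc ip I P) \<le> sqrt B"
    (is "?bessel \<longleftrightarrow> ?wd \<and> ?bdd \<and> ?le")
proof
  define q where "q f = (\<Sum>\<^sub>\<infinity>i\<in>I. inner (P i f) f)" for f
  let ?R = "sqrt_family sc ip I P"
  have norm_R: "ell2_norm I (?R f) = sqrt (q f)" for f
    using ell2_norm_sqrt_family[OF P] by (simp add: q_def)
  have pos: "pos_sym (P i)" if "i \<in> I" for i using P[OF that] by (simp add: positive_op_iff)
  have q_nonneg: "0 \<le> q f" for f
    unfolding q_def by (rule infsum_nonneg) (simp add: pos_symD(3)[OF pos])
  {
    assume bessel: ?bessel
    have summable: "(\<lambda>i. P i f) summable_on I" and sq: "(norm (\<Sum>\<^sub>\<infinity>i\<in>I. P i f))\<^sup>2 \<le> B * q f" for f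
      unfolding q_def using positive_family_summable[where A = I and Q = P and B = B, OF pos] bessel \<open>0 < B\<close> by auto
    have wd: ?wd
      unfolding synth_well_defined_def
    proof (intro conjI allI impI)
      fix f show "?R f \<in> ell2 I" using bessel by (simp add: sqrt_family_in_ell2_iff[OF P])
      show "(\<lambda>i. P i f) summable_on I" by (rule summable)
    next
      fix f g assume "?R f = ?R g"
      then show "(\<Sum>\<^sub>\<infinity>i\<in>I. P i f) = (\<Sum>\<^sub>\<infinity>i\<in>I. P i g)"
        by (intro infsum_cong sqrt_family_determines[OF P])
    qed
    have le: "norm (synth sc ip I P (?R f)) \<le> sqrt B * ell2_norm I (?R f)" for f
      using real_le_rsqrt[OF sq[of f]]
      by (simp add: synth_sqrt_family[OF wd] norm_R real_sqrt_mult)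
    have ?bdd
      unfolding ell2_bounded_on_def synth_dom_def using le by blast
    moreover have ?le
      unfolding ell2_onorm_on_def
    proof (rule cSUP_least)
      show "synth_dom sc ip I P \<noteq> {}" by (simp add: synth_dom_def)
      fix g assume "g \<in> synth_dom sc ip I P"
      then obtain f where g: "g = ?R f" by (auto simp: synth_dom_def)
      show "norm (synth sc ip I P g) / ell2_norm I g \<le> sqrt B"
      \<comment> \<open>A family of norm zero makes the quotient a division by zero, hence
        \<open>0\<close>.\<close>
      proof (cases "q f = 0")
        case False
        then have "0 < ell2_norm I (?R f)" using q_nonneg[of f] by (simp add: norm_R)
        then show ?thesis using le[of f] by (simp add: g divide_le_eq)
      qed (use \<open>0 < B\<close> in \<open>simp add: g norm_R\<close>)
    qed
    ultimately show "?wd \<and> ?bdd \<and> ?le" using wd by blast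
  }
  {
    assume rhs: "?wd \<and> ?bdd \<and> ?le"
    then have wd: ?wd by blast
    obtain M where M: "\<And>f. norm (synth sc ip I P (?R f)) \<le> M * ell2_norm I (?R f)"
      using rhs unfolding ell2_bounded_on_def synth_dom_def by blast
    \<comment> \<open>A real supremum dominates its elements only if the set is bounded above, so
      boundedness of the operator is first turned into \<open>bdd_above\<close>.\<close>
    have "norm (synth sc ip I P (?R f)) / ell2_norm I (?R f) \<le> \<bar>M\<bar>" for f
    proof (cases "q f = 0")
      case False
      then have "0 < ell2_norm I (?R f)" using q_nonneg[of f] by (simp add: norm_R)
      then show ?thesis
        using order.trans[OF M mult_right_mono[OF abs_ge_self]] by (simp add: divide_le_eq)
    qed (simp add: norm_R)
    then have "bdd_above ((\<lambda>g. norm (synth sc ip I P g) / ell2_norm I g) ` synth_dom sc ip I P)"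
      by (auto simp: synth_dom_def intro!: bdd_aboveI2)
    from cSUP_upper[OF _ this]
    have quot: "norm (synth sc ip I P (?R f)) / ell2_norm I (?R f) \<le> sqrt B" for f
      using rhs unfolding ell2_onorm_on_def synth_dom_def by (meson order.trans rangeI)
    show ?bessel
    proof (intro allI conjI)
      fix f
      show "(\<lambda>i. inner (P i f) f) summable_on I"
        using wd by (simp add: synth_well_defined_def sqrt_family_in_ell2_iff[OF P])
      have "q f \<le> B * (norm f)\<^sup>2"
      proof (cases "q f = 0")
        case False
        then have pos_q: "0 < q f" using q_nonneg[of f] by simp
        have "((\<lambda>i. P i f) has_sum (\<Sum>\<^sub>\<infinity>i\<in>I. P i f)) I"
          using wd unfolding synth_well_defined_def by (intro has_sum_infsum) blast
        then have "((\<lambda>i. inner (P i f) f) has_sum inner (\<Sum>\<^sub>\<infinity>i\<in>I. P i f) f) I"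
          by (rule has_sum_bounded_linear[OF bounded_linear_inner_left])
        then have "q f = inner (\<Sum>\<^sub>\<infinity>i\<in>I. P i f) f"
          unfolding q_def by (rule infsumI)
        also have "\<dots> \<le> norm (\<Sum>\<^sub>\<infinity>i\<in>I. P i f) * norm f" by (rule norm_cauchy_schwarz)
        also have "\<dots> \<le> (sqrt B * sqrt (q f)) * norm f"
          using quot[of f] pos_q
          by (intro mult_right_mono) (simp_all add: synth_sqrt_family[OF wd] norm_R divide_le_eq)
        \<comment> \<open>One factor \<open>sqrt (q f)\<close> cancels; this is why
          \<open>q f = 0\<close> is treated apart.\<close>
        finally have "sqrt (q f) * sqrt (q f) \<le> sqrt (q f) * (sqrt B * norm f)"
          using pos_q by (simp add: mult_ac)
        then have "sqrt (q f) \<le> sqrt B * norm f"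
          by (rule mult_left_le_imp_le) (use pos_q in simp)
        then have "(sqrt (q f))\<^sup>2 \<le> (sqrt B * norm f)\<^sup>2"
          using pos_q by (intro power_mono) auto
        then show ?thesis using pos_q \<open>0 < B\<close> by (simp add: power_mult_distrib)
      qed (use \<open>0 < B\<close> in simp)
      then show "(\<Sum>\<^sub>\<infinity>i\<in>I. inner (P i f) f) \<le> B * (norm f)\<^sup>2" by (simp add: q_def)
    qed
  }
qed

end

section \<open>Reduction of the controlled Bessel condition to real series\<close>

theorem theorem2p4:
  fixes sc :: "'k::rc_scalar \<Rightarrow> 'h::{real_inner, complete_space} \<Rightarrow> 'h"
    and ip :: "'h \<Rightarrow> 'h \<Rightarrow> 'k"
    and I :: "'i set"
    and X :: "'i \<Rightarrow> ('k, 'v) hspace"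
    and C C' :: "'h \<Rightarrow> 'h"
    and \<Lambda> :: "'i \<Rightarrow> 'h \<Rightarrow> 'v"
    and P :: "'i \<Rightarrow> 'h \<Rightarrow> 'h"
    and B :: real
  defines "P \<equiv> ctrl_op ip X C C' \<Lambda>"
  assumes "hilbert_type sc ip"
    and "separable_space (euclidean :: 'h topology)"
    and "\<forall>i\<in>I. hilbert_space (X i)"
    and "bounded_op sc C" and "bij C" and "bounded_op sc (inv_into UNIV C)"
    and "bounded_op sc C'" and "bij C'" and "bounded_op sc (inv_into UNIV C')"
    and "\<forall>i\<in>I. bounded_op_to sc (X i) (\<Lambda> i)"
    and "\<forall>i\<in>I. positive_op sc ip (P i)"
    and "0 < B"
  shows "controlled_g_Bessel X C C' I \<Lambda> B \<longleftrightarrow>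
    synth_well_defined sc ip I P \<and>
    ell2_bounded_on I (synth_dom sc ip I P) (synth sc ip I P) \<and>
    ell2_onorm_on I (synth_dom sc ip I P) (synth sc ip I P) \<le> sqrt B"
proof -
  interpret hilbert_type sc ip by fact
  have P: "positive_op sc ip (P i)" if "i \<in> I" for i using assms(12) that by blast
  have "hip (X i) (\<Lambda> i (C' f)) (\<Lambda> i (C f)) = of_real (inner (P i f) f)" if "i \<in> I" for i f
    using ip_ctrl_op[where X = X and i = i and C = C and \<Lambda> = \<Lambda> and C' = C' and f = f and g = f]
      ip_positive_op[OF P[OF that], of f] assms that by (simp add: P_def)
  \<comment> \<open>The sum in the Bessel condition is taken in \<open>'k\<close>; as its terms are
    embedded reals, it converges to \<open>of_real s\<close> exactly when the real series converges
    to \<open>s\<close>.\<close>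
  then have "((\<lambda>i. hip (X i) (\<Lambda> i (C' f)) (\<Lambda> i (C f))) has_sum of_real s) I \<longleftrightarrow>
      ((\<lambda>i. inner (P i f) f) has_sum s) I" for f s
    by (subst has_sum_of_real_iff[symmetric, where ?'a = 'k]) (rule has_sum_cong, simp)
  then have bessel: "controlled_g_Bessel X C C' I \<Lambda> B \<longleftrightarrow>
      (\<forall>f. \<exists>s. ((\<lambda>i. inner (P i f) f) has_sum s) I \<and> s \<le> B * (norm f)\<^sup>2)"
    by (simp add: controlled_g_Bessel_def)
  have "(\<exists>s. (g has_sum s) I \<and> s \<le> b) \<longleftrightarrow> g summable_on I \<and> infsum g I \<le> b" for g :: "'i \<Rightarrow> real" and b
    using infsumI has_sum_infsum has_sum_imp_summable by blast
  with bessel show ?thesis using synth_bounded_iff[OF P \<open>0 < B\<close>] by simp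
qed

end
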